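(* Let $\varphi$ be a univalent analytic function on $\mathbb{D}$ with positive real part which maps $\mathbb{D}$ onto a region that is starlike with respect to $1$ and symmetric with respect to the real axis, normalized by $\varphi(0)=1$ and $\varphi'(0)>0$, and write $\varphi(z)=1+B_1z+B_2z^2+\cdots$ (so $B_1>0$). Let $f\in\mathcal{K}_s(\varphi)$. Then the coefficients $d_2$ and $d_3$ of the inverse function $f^{-1}(w)=w+d_2w^2+d_3w^3+\cdots$ (defined and analytic near $w=0$) satisfy, for every $\mu\in\mathbb{C}$, \[ |d_3-\mu d_2^2|\leq \frac13+\max\left(\frac{B_1}{3},\ \left|\frac{B_2}{3}-\frac{(2-\mu) B_1^2}{4}\right|\right). \]
   Context: $\mathbb{D}=\{z\in\mathbb{C}:|z|<1\}$. $\mathcal{A}$ is the class of analytic functions $f$ on $\mathbb{D}$ with $f(0)=0$ and $f'(0)=1$. $S^*(1/2)$ is the class of functions $g\in\mathcal{A}$ that are starlike of order $1/2$, i.e. $\operatorname{Re}(zg'(z)/g(z))>1/2$ for all $z\in\mathbb{D}$ (the quotient taking the value $1$ at $z=0$). Subordination: for $p,q$ analytic in $\mathbb{D}$, $p\prec q$ means that there is an analytic function $w$ on $\mathbb{D}$ with $w(0)=0$ and $|w(z)|<1$ such that $p(z)=q(w(z))$ for all $z\in\mathbb{D}$. For a function $\varphi$ analytic on $\mathbb{D}$ with positive real part, $\mathcal{K}_s(\varphi)$ is the class of functions $f\in\mathcal{A}$ for which there exists $g\in S^*(1/2)$ such that \[ -\frac{z^2f'(z)}{g(z)g(-z)}\prec\varphi(z)\quad(z\in\mathbb{D}),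 \] where the left-hand side is extended to $z=0$ by its limit value $1$. Functions in $\mathcal{K}_s(\varphi)$ are univalent; $f^{-1}$ denotes the inverse of $f$, satisfying $f^{-1}(f(z))=z$ for $z\in\mathbb{D}$ and $f(f^{-1}(w))=w$ for $|w|<r_0(f)$, where $r_0(f)\ge 1/4$. *)

theory Defs
  imports "HOL-Complex_Analysis.Complex_Analysis"
begin

abbreviation unit_disc :: "complex set" where
  "unit_disc \<equiv> ball 0 1"

definition class_A :: "(complex \<Rightarrow> complex) set" where
  "class_A = {f. f holomorphic_on unit_disc \<and> f 0 = 0 \<and> deriv f 0 = 1}"

(* A zero of g at some z \<noteq> 0 makes the quotient 0 (division by zero), so the strict
   inequality also excludes such zeros, as the analytic definition does. *)
definition starlike_half :: "(complex \<Rightarrow> complex) set" where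
  "starlike_half =
     {g \<in> class_A. \<forall>z\<in>unit_disc. Re (if z = 0 then 1 else z * deriv g z / g z) > 1 / 2}"

definition subordinate :: "(complex \<Rightarrow> complex) \<Rightarrow> (complex \<Rightarrow> complex) \<Rightarrow> bool" where
  "subordinate p q \<longleftrightarrow>
     (\<exists>w. w holomorphic_on unit_disc \<and> w 0 = 0 \<and>
          (\<forall>z\<in>unit_disc. norm (w z) < 1 \<and> p z = q (w z)))"

definition K_s :: "(complex \<Rightarrow> complex) \<Rightarrow> (complex \<Rightarrow> complex) set" where
  "K_s \<phi> =
     {f \<in> class_A. \<exists>g\<in>starlike_half.
        subordinate (\<lambda>z. if z = 0 then 1 else - (z\<^sup>2 * deriv f z) / (g z * g (- z))) \<phi>}"

(* Only the germ of the inverse at 0 matters for its Taylor coefficients. The lemma below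
   shows that the global inverse of a univalent function of class A is a case of this. *)
definition inverse_near_0 :: "(complex \<Rightarrow> complex) \<Rightarrow> (complex \<Rightarrow> complex) \<Rightarrow> bool" where
  "inverse_near_0 f F \<longleftrightarrow>
     F analytic_on {0} \<and>
     (\<forall>\<^sub>F z in nhds 0. F (f z) = z) \<and> (\<forall>\<^sub>F w in nhds 0. f (F w) = w)"

lemma inverse_near_0_inv_into:
  assumes f: "f \<in> class_A" and inj: "inj_on f unit_disc"
  shows "inverse_near_0 f (inv_into unit_disc f)"
proof -
  let ?F = "inv_into unit_disc f"
  have hol: "f holomorphic_on unit_disc" and f0: "f 0 = 0"
    using f by (auto simp: class_A_def)
  obtain g where g: "g holomorphic_on (f ` unit_disc)" "\<And>z. z \<in> unit_disc \<Longrightarrow> g (f z) = z"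
    using holomorphic_has_inverse[OF hol open_ball inj] by metis
  have op: "open (f ` unit_disc)"
    by (rule open_mapping_thm3[OF hol open_ball inj])
  have 0: "0 \<in> f ` unit_disc"
    using f0 by (metis centre_in_ball imageI zero_less_one)
  have eq: "?F w = g w" if "w \<in> f ` unit_disc" for w
    using that g(2) inj by auto
  have "?F holomorphic_on (f ` unit_disc)"
    using g(1) eq by (simp cong: holomorphic_cong)
  then have "?F analytic_on {0}"
    using op 0 by (meson analytic_on_open analytic_on_subset empty_subsetI insert_subset)
  moreover have "\<forall>\<^sub>F z in nhds 0. ?F (f z) = z"
    using eventually_nhds_in_open[of unit_disc 0] inj by (auto elim: eventually_mono)
  moreover have "\<forall>\<^sub>F w in nhds 0. f (?F w) = w"
    using eventually_nhds_in_open[OF op 0] by eventually_elim (rule f_inv_into_f)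
  ultimately show ?thesis
    unfolding inverse_near_0_def by blast
qed

end

theory Submission
  imports Defs
begin

text \<open>
  Write \<open>g = z + g\<^sub>2 z\<^sup>2 + g\<^sub>3 z\<^sup>3 + \<dots>\<close> and let \<open>w\<close> be the Schwarz function of the subordination.
  Comparing coefficients in \<open>- z\<^sup>2 f'(z) = g(z) g(-z) \<phi>(w(z))\<close> gives \<open>2 a\<^sub>2 = B\<^sub>1 w\<^sub>1\<close> and
  \<open>3 a\<^sub>3 = (2 g\<^sub>3 - g\<^sub>2\<^sup>2) + B\<^sub>1 w\<^sub>2 + B\<^sub>2 w\<^sub>1\<^sup>2\<close>. The number \<open>c = 2 g\<^sub>3 - g\<^sub>2\<^sup>2\<close> is the second
  coefficient of \<open>z g' / g\<close>. Since \<open>d\<^sub>2 = - a\<^sub>2\<close> and \<open>d\<^sub>3 = 2 a\<^sub>2\<^sup>2 - a\<^sub>3\<close>, the functional is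
  \<open>- c / 3 - B\<^sub>1 / 3 (w\<^sub>2 + t w\<^sub>1\<^sup>2)\<close> for a suitable \<open>t\<close>, and both terms are controlled by
  \<open>|w\<^sub>2 + t w\<^sub>1\<^sup>2| \<le> max(1, |t|)\<close>, a consequence of the Schwarz--Pick inequality
  \<open>|w\<^sub>2| \<le> 1 - |w\<^sub>1|\<^sup>2\<close>.
\<close>

section \<open>Second coefficients of Schwarz functions\<close>

lemma has_fps_expansion_unique_eventually:
  fixes f g :: "complex \<Rightarrow> complex"
  assumes "f has_fps_expansion F" "g has_fps_expansion G" "\<forall>\<^sub>F z in nhds 0. f z = g z"
  shows "F = G"
proof (rule fps_expansion_unique_complex)
  show "g has_fps_expansion F"
    using assms(1) has_fps_expansion_cong[OF assms(3) refl] by blast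
qed (rule assms(2))

text \<open>Writing \<open>w z = z * h z\<close> turns the two coefficients into \<open>h 0\<close>
  and \<open>deriv h 0\<close>. Unless \<open>w\<close> is a rotation, \<open>h\<close> maps the
  disc into itself, and the claim is the Schwarz--Pick inequality for \<open>h\<close> at 0.\<close>

lemma norm_nth2_le_Schwarz:
  fixes w :: "complex \<Rightarrow> complex"
  assumes hol: "w holomorphic_on ball 0 1" and w0: "w 0 = 0"
    and lt1: "\<And>z. norm z < 1 \<Longrightarrow> norm (w z) < 1"
    and W: "w has_fps_expansion W"
  shows "norm (fps_nth W 2) \<le> 1 - (norm (fps_nth W 1))\<^sup>2"
proof -
  obtain h where holh: "h holomorphic_on ball 0 1"
    and wh: "\<And>z. norm z < 1 \<Longrightarrow> w z = z * h z" and dw: "deriv w 0 = h 0"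
    using Schwarz3[OF hol w0] by blast
  define H where "H = fps_expansion h 0"
  have H: "h has_fps_expansion H"
    unfolding H_def by (rule has_fps_expansion_fps_expansion[OF open_ball _ holh]) auto
  have "\<forall>\<^sub>F z in nhds 0. z * h z = w z"
    using eventually_nhds_in_open[of "ball 0 1" "0::complex"] wh by (auto elim: eventually_mono)
  then have WH: "fps_X * H = W"
    by (rule has_fps_expansion_unique_eventually[OF has_fps_expansion_mult[OF has_fps_expansion_fps_X H] W])
  have W1: "fps_nth W 1 = h 0" and W2: "fps_nth W 2 = deriv h 0"
    using fps_nth_fps_expansion[OF H, of 0] fps_nth_fps_expansion[OF H, of 1]
    by (simp_all add: WH[symmetric] numeral_2_eq_2)
  show ?thesis
  proof (cases "\<exists>z. (norm z < 1 \<and> z \<noteq> 0 \<and> norm (w z) = norm z) \<or> norm (deriv w 0) = 1")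
    \<comment> \<open>In the equality case \<open>h\<close> is a unimodular constant and does not
      map into the open disc. Here \<open>w\<close> is a rotation, so its second coefficient
      vanishes.\<close>
    case True
    then obtain \<alpha> where \<alpha>: "\<And>z. norm z < 1 \<Longrightarrow> w z = \<alpha> * z" and n: "norm \<alpha> = 1"
      using Schwarz_Lemma(3)[OF hol w0 lt1, of 0] by auto
    have "\<forall>\<^sub>F z in nhds 0. \<alpha> * z = w z"
      using eventually_nhds_in_open[of "ball 0 1" "0::complex"] \<alpha> by (auto elim: eventually_mono)
    then have "fps_const \<alpha> * fps_X = W"
      by (rule has_fps_expansion_unique_eventually
          [OF has_fps_expansion_cmult_left[OF has_fps_expansion_fps_X] W])
    then show ?thesis using n by auto
  next
    case False
    have h1: "norm (h z) < 1" if "norm z < 1" for z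
    proof (cases "z = 0")
      case True
      then show ?thesis
        using Schwarz_Lemma(2)[OF hol w0 lt1, of 0] False dw by auto
    next
      case nz: False
      have "norm (w z) \<le> norm z" "norm (w z) \<noteq> norm z"
        using Schwarz_Lemma(1)[OF hol w0 lt1 that] False nz that by auto
      then have "norm z * norm (h z) < norm z * 1"
        using wh[OF that] by (simp add: norm_mult)
      then show ?thesis using nz by (simp add: mult_less_cancel_left)
    qed
    define a where "a = h 0"
    have a: "norm a < 1" using h1[of 0] by (simp add: a_def)
    \<comment> \<open>The disc automorphism moves \<open>h 0\<close> to 0, so the Schwarz lemma
      bounds the derivative of \<open>k\<close> at 0, which is \<open>deriv h 0\<close> divided by 1
      - |a|^2.\<close>
    define k where "k = Moebius_function 0 a \<circ> h"
    have holk: "k holomorphic_on ball 0 1" unfolding k_def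
      by (rule holomorphic_on_compose_gen[OF holh Moebius_function_holomorphic[OF a]])
        (use h1 in auto)
    have "norm (deriv k 0) \<le> 1"
      by (rule Schwarz_Lemma(2)[OF holk, of 0])
        (auto simp: k_def Moebius_function_eq_zero a_def
          intro!: Moebius_function_norm_lt_1 h1)
    moreover have "(k has_field_derivative deriv h 0 / (1 - cnj a * a)) (at 0)"
    proof -
      have nz: "1 - cnj a * a \<noteq> 0"
        using a by (metis complex_mod_cnj norm_mult_less norm_one
            less_irrefl mult_1 right_minus_eq)
      have dh: "(h has_field_derivative deriv h 0) (at 0)"
        using holomorphic_derivI[OF holh open_ball] by simp
      have "((\<lambda>z. (h z - a) / (1 - cnj a * h z)) has_field_derivative
          ((deriv h 0 - 0) * (1 - cnj a * h 0) - (h 0 - a) * (0 - cnj a * deriv h 0))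
            / ((1 - cnj a * h 0) * (1 - cnj a * h 0))) (at 0)"
        using nz by (intro DERIV_divide DERIV_diff DERIV_const DERIV_cmult dh)
          (simp_all add: a_def)
      then show ?thesis
        unfolding k_def comp_def Moebius_function_simple
        using nz by (simp add: a_def[symmetric])
    qed
    moreover have a2: "(norm a)\<^sup>2 < 1"
      using a by (simp add: abs_square_less_1)
    moreover have "norm (1 - cnj a * a) = 1 - (norm a)\<^sup>2"
    proof -
      have "1 - cnj a * a = of_real (1 - (norm a)\<^sup>2)"
        using complex_norm_square[of a] by (simp add: mult.commute)
      then show ?thesis
        using a2 by (simp only: norm_of_real)
    qed
    ultimately have "norm (deriv h 0) \<le> 1 - (norm a)\<^sup>2"
      by (simp add: DERIV_imp_deriv norm_divide divide_le_eq)
    then show ?thesis using W1 W2 by (simp add: a_def)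
  qed
qed

text \<open>With \<open>?x\<close> in [0, 1], the previous bound leaves a convex combination of 1
  and |t|.\<close>

lemma norm_nth2_plus_le_max:
  fixes w :: "complex \<Rightarrow> complex"
  assumes "w holomorphic_on ball 0 1" and "w 0 = 0"
    and "\<And>z. norm z < 1 \<Longrightarrow> norm (w z) < 1"
    and "w has_fps_expansion W"
  shows "norm (fps_nth W 2 + t * (fps_nth W 1)\<^sup>2) \<le> max 1 (norm t)"
proof -
  let ?x = "(norm (fps_nth W 1))\<^sup>2"
  have le: "norm (fps_nth W 2) \<le> 1 - ?x"
    by (rule norm_nth2_le_Schwarz[OF assms])
  then have x1: "?x \<le> 1" using norm_ge_zero[of "fps_nth W 2"] by linarith
  have "norm (fps_nth W 2 + t * (fps_nth W 1)\<^sup>2) \<le> (1 - ?x) * 1 + ?x * norm t"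
    using norm_triangle_ineq[of "fps_nth W 2" "t * (fps_nth W 1)\<^sup>2"] le
    by (simp add: norm_mult norm_power mult.commute)
  also have "\<dots> \<le> (1 - ?x) * max 1 (norm t) + ?x * max 1 (norm t)"
    using x1 by (intro add_mono mult_left_mono) auto
  finally show ?thesis by (simp add: algebra_simps)
qed

section \<open>Starlike functions of order 1/2\<close>

text \<open>The quotient z g'/g has the form 1/(1 - w) with a Schwarz function \<open>w\<close>, so
  the coefficient estimate applies with t = 1. The function z/(1 - z) attains the bound.\<close>

lemma starlike_half_coeff_bound:
  assumes g: "g \<in> starlike_half" and G: "g has_fps_expansion G"
  shows "norm (2 * fps_nth G 3 - (fps_nth G 2)\<^sup>2) \<le> 1"
proof -
  have hol: "g holomorphic_on ball 0 1" and g0: "g 0 = 0" and g1: "deriv g 0 = 1"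
    and re: "\<And>z. norm z < 1 \<Longrightarrow> z \<noteq> 0 \<Longrightarrow> Re (z * deriv g z / g z) > 1 / 2"
    using g by (auto simp: starlike_half_def class_A_def split: if_splits)
  have gnz: "g z \<noteq> 0" and dnz: "deriv g z \<noteq> 0" if "norm z < 1" "z \<noteq> 0" for z
    using re[OF that] by auto
  have dnz': "deriv g z \<noteq> 0" if "norm z < 1" for z
    using dnz[OF that] g1 by (cases "z = 0") auto
  obtain h where holh: "h holomorphic_on ball 0 1"
    and gh: "\<And>z. norm z < 1 \<Longrightarrow> g z = z * h z" and h0: "h 0 = 1"
    using Schwarz3[OF hol g0] g1 by metis
  \<comment> \<open>\<open>w = 1 - 1 / p\<close> with \<open>p = z g' / g\<close>; \<open>Re p > 1 / 2\<close> says exactly that \<open>|p - 1| < |p|\<close>,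
    and \<open>w\<^sub>2 + w\<^sub>1\<^sup>2\<close> is the second coefficient of \<open>p\<close>.\<close>
  define w where "w = (\<lambda>z. 1 - h z / deriv g z)"
  have holw: "w holomorphic_on ball 0 1"
    unfolding w_def using hol holh dnz' by (intro holomorphic_intros) auto
  have w0: "w 0 = 0" by (simp add: w_def h0 g1)
  have w1: "norm (w z) < 1" if z: "norm z < 1" for z
  proof (cases "z = 0")
    case False
    define p where "p = z * deriv g z / g z"
    have p: "Re p > 1 / 2" unfolding p_def by (rule re[OF z False])
    then have pnz: "p \<noteq> 0" by auto
    have "w z = (p - 1) / p"
      using gnz[OF z False] dnz[OF z False] gh[OF z] False by (simp add: w_def p_def field_simps)
    moreover have "norm (p - 1) < norm p"
      using p by (simp add: cmod_def power2_eq_square algebra_simps)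
    ultimately show ?thesis using pnz by (simp add: norm_divide)
  qed (simp add: w0)
  define W where "W = fps_expansion w 0"
  have W: "w has_fps_expansion W"
    unfolding W_def by (rule has_fps_expansion_fps_expansion[OF open_ball _ holw]) auto
  have "norm (fps_nth W 2 + 1 * (fps_nth W 1)\<^sup>2) \<le> max 1 (norm (1::complex))"
    by (rule norm_nth2_plus_le_max[OF holw w0 w1 W])
  moreover have "fps_nth W 2 + (fps_nth W 1)\<^sup>2 = 2 * fps_nth G 3 - (fps_nth G 2)\<^sup>2"
  proof -
    \<comment> \<open>Clearing denominators in the definition of \<open>w\<close> lets the
      coefficients be compared in a product rather than a quotient of power series.\<close>
    have ev: "\<forall>\<^sub>F z in nhds 0. z * (1 - w z) * deriv g z = g z"
      using eventually_nhds_in_open[of "ball 0 1" "0::complex"]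
      by (auto elim!: eventually_mono simp: w_def dnz' gh)
    have "(\<lambda>z. z * (1 - w z) * deriv g z) has_fps_expansion fps_X * (1 - W) * fps_deriv G"
      by (intro fps_expansion_intros W G)
    from has_fps_expansion_unique_eventually[OF this G ev]
    have eq: "G = fps_X * ((1 - W) * fps_deriv G)"
      by (simp add: mult.assoc)
    have G1: "fps_nth G 1 = 1"
      using fps_nth_fps_expansion[OF G, of 1] g1 by simp
    have W0: "fps_nth W 0 = 0"
      using fps_nth_fps_expansion[OF W, of 0] w0 by simp
    have "fps_nth G 2 = fps_nth ((1 - W) * fps_deriv G) 1"
         "fps_nth G 3 = fps_nth ((1 - W) * fps_deriv G) 2"
      by (subst eq, simp add: numeral_eq_Suc)+
    then have "fps_nth G 2 = 2 * fps_nth G 2 - fps_nth W 1"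
              "fps_nth G 3 = 3 * fps_nth G 3 - 2 * fps_nth W 1 * fps_nth G 2 - fps_nth W 2"
      using G1 W0 by (simp_all add: fps_mult_nth numeral_eq_Suc algebra_simps)
    then have "fps_nth W 1 = fps_nth G 2" "fps_nth W 2 = 2 * fps_nth G 3 - 2 * (fps_nth G 2)\<^sup>2"
      by (simp_all add: power2_eq_square algebra_simps)
    then show ?thesis by simp
  qed
  ultimately show ?thesis by simp
qed

section \<open>Coefficients of the inverse and of functions in \<open>K_s\<close>\<close>

text \<open>Both formulas come from the coefficients of orders 1 to 3 in
  \<open>D oo A = fps_X\<close>.\<close>

lemma inverse_near_0_nth:
  assumes inv: "inverse_near_0 f F" and f: "f has_fps_expansion A" and F: "F has_fps_expansion D"
    and A0: "fps_nth A 0 = 0" and A1: "fps_nth A 1 = 1"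
  shows "fps_nth D 2 = - fps_nth A 2"
    and "fps_nth D 3 = 2 * (fps_nth A 2)\<^sup>2 - fps_nth A 3"
proof -
  have ev: "\<forall>\<^sub>F z in nhds 0. (F \<circ> f) z = z"
    using inv by (simp add: inverse_near_0_def)
  have "(F \<circ> f) has_fps_expansion (D oo A)"
    by (rule has_fps_expansion_compose[OF F f A0])
  then have eq: "D oo A = fps_X"
    using has_fps_expansion_fps_X ev by (rule has_fps_expansion_unique_eventually)
  have D1: "fps_nth D 1 = 1" and D2: "fps_nth D 2 + fps_nth A 2 = 0"
    and D3: "fps_nth D 3 + 2 * fps_nth A 2 * fps_nth D 2 + fps_nth A 3 = 0"
    using arg_cong[OF eq, of "\<lambda>p. fps_nth p 1"] arg_cong[OF eq, of "\<lambda>p. fps_nth p 2"]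
      arg_cong[OF eq, of "\<lambda>p. fps_nth p 3"] A0 A1
    by (simp_all add: fps_compose_nth fps_mult_nth numeral_eq_Suc algebra_simps)
  show D2': "fps_nth D 2 = - fps_nth A 2"
    using D2 by (simp add: eq_neg_iff_add_eq_0)
  show "fps_nth D 3 = 2 * (fps_nth A 2)\<^sup>2 - fps_nth A 3"
    using D3 unfolding D2' by (simp add: power2_eq_square algebra_simps add_eq_0_iff)
qed

text \<open>The product g(z) g(-z) is even and begins -z^2 - c z^4, where c is the quantity bounded
  by \<open>starlike_half_coeff_bound\<close>. Up to the order needed, \<open>g\<close> therefore
  enters only through c.\<close>

lemma K_s_coeffs:
  assumes f: "f \<in> K_s \<phi>" and A: "f has_fps_expansion A" and B: "\<phi> has_fps_expansion B"
    and \<phi>0: "\<phi> 0 = 1"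
  obtains w W c where "w holomorphic_on ball 0 1" "w 0 = 0" "\<And>z. norm z < 1 \<Longrightarrow> norm (w z) < 1"
    "w has_fps_expansion W" "norm c \<le> 1"
    "2 * fps_nth A 2 = fps_nth B 1 * fps_nth W 1"
    "3 * fps_nth A 3 = c + fps_nth B 1 * fps_nth W 2 + fps_nth B 2 * (fps_nth W 1)\<^sup>2"
proof -
  obtain g w where g: "g \<in> starlike_half" and hw: "w holomorphic_on ball 0 1" and w0: "w 0 = 0"
    and wlt: "\<And>z. norm z < 1 \<Longrightarrow> norm (w z) < 1"
    and eq: "\<And>z. norm z < 1 \<Longrightarrow>
       (if z = 0 then 1 else - (z\<^sup>2 * deriv f z) / (g z * g (- z))) = \<phi> (w z)"
    using f by (auto simp: K_s_def subordinate_def)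
  have hg: "g holomorphic_on ball 0 1" and g0: "g 0 = 0" and g1: "deriv g 0 = 1"
    and re: "\<And>z. norm z < 1 \<Longrightarrow> z \<noteq> 0 \<Longrightarrow> Re (z * deriv g z / g z) > 1 / 2"
    using g by (auto simp: starlike_half_def class_A_def split: if_splits)
  have gnz: "g z \<noteq> 0" if "norm z < 1" "z \<noteq> 0" for z
    using re[OF that] by auto
  define G W where "G = fps_expansion g 0" and "W = fps_expansion w 0"
  have G: "g has_fps_expansion G" and W: "w has_fps_expansion W"
    unfolding G_def W_def
    by (rule has_fps_expansion_fps_expansion[OF open_ball]; use hg hw in auto)+
  have G0: "fps_nth G 0 = 0" and G1: "fps_nth G 1 = 1" and W0: "fps_nth W 0 = 0"
    and B0: "fps_nth B 0 = 1"
    using fps_nth_fps_expansion[OF G, of 0] fps_nth_fps_expansion[OF G, of 1]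
      fps_nth_fps_expansion[OF W, of 0] fps_nth_fps_expansion[OF B, of 0] g0 g1 w0 \<phi>0 by auto
  have mX: "uminus has_fps_expansion - (fps_X :: complex fps)"
    by (intro fps_expansion_intros)
  have "(\<lambda>z. z ^ 2 * deriv f z) has_fps_expansion fps_X ^ 2 * fps_deriv A"
    by (intro fps_expansion_intros A)
  moreover have "(\<lambda>z. - ((\<phi> \<circ> w) z * g z * (g \<circ> uminus) z)) has_fps_expansion
      - ((B oo W) * G * (G oo - fps_X))"
    by (intro fps_expansion_intros B W G mX) (auto simp: W0)
  moreover have "\<forall>\<^sub>F z in nhds 0. z ^ 2 * deriv f z = - ((\<phi> \<circ> w) z * g z * (g \<circ> uminus) z)"
  proof -
    \<comment> \<open>Away from 0 the denominator is nonzero and can be cleared; at 0 both sides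
      vanish.\<close>
    have "z ^ 2 * deriv f z = - (\<phi> (w z) * g z * g (- z))" if "norm z < 1" for z
      using eq[OF that, symmetric] gnz[OF that] gnz[of "- z"] that by (auto simp: g0 field_simps)
    then show ?thesis
      using eventually_nhds_in_open[of "ball 0 1" "0::complex"] by (auto elim: eventually_mono)
  qed
  ultimately have "fps_X ^ 2 * fps_deriv A = - ((B oo W) * G * (G oo - fps_X))"
    by (rule has_fps_expansion_unique_eventually)
  then have E: "fps_X ^ 2 * fps_deriv A = - ((B oo W) * (G * (G oo - fps_X)))"
    by (simp add: mult.assoc)
  define P where "P = G * (G oo - fps_X)"
  have P: "fps_nth P 0 = 0" "fps_nth P 1 = 0" "fps_nth P 2 = -1" "fps_nth P 3 = 0"
    "fps_nth P 4 = - (2 * fps_nth G 3 - (fps_nth G 2)\<^sup>2)"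
    using G0 G1 unfolding P_def fps_compose_uminus'
    by (simp_all add: fps_mult_nth numeral_eq_Suc power2_eq_square algebra_simps)
  define Q where "Q = B oo W"
  have Q: "fps_nth Q 0 = 1" "fps_nth Q 1 = fps_nth B 1 * fps_nth W 1"
    "fps_nth Q 2 = fps_nth B 1 * fps_nth W 2 + fps_nth B 2 * (fps_nth W 1)\<^sup>2"
    using W0 B0 unfolding Q_def
    by (simp_all add: fps_compose_nth fps_mult_nth numeral_eq_Suc power2_eq_square algebra_simps)
  \<comment> \<open>The left side has coefficient (n - 1) a_(n-1) at index n, so indices 3 and 4
    give 2 a_2 and 3 a_3.\<close>
  have E3: "fps_nth (fps_X ^ 2 * fps_deriv A) 3 = - fps_nth (Q * P) 3"
    and E4: "fps_nth (fps_X ^ 2 * fps_deriv A) 4 = - fps_nth (Q * P) 4"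
    unfolding E P_def Q_def by simp_all
  have "2 * fps_nth A 2 = fps_nth B 1 * fps_nth W 1"
    using E3 P Q by (simp add: fps_X_power_mult_nth fps_mult_nth numeral_eq_Suc)
  moreover have "3 * fps_nth A 3 = (2 * fps_nth G 3 - (fps_nth G 2)\<^sup>2)
      + fps_nth B 1 * fps_nth W 2 + fps_nth B 2 * (fps_nth W 1)\<^sup>2"
    using E4 P Q by (simp add: fps_X_power_mult_nth fps_mult_nth numeral_eq_Suc)
  ultimately show thesis
    using that hw w0 wlt W starlike_half_coeff_bound[OF g G] by blast
qed

theorem corollary2p1:
  fixes \<phi> f F :: "complex \<Rightarrow> complex" and B d :: "complex fps" and \<mu> :: complex
  assumes "\<phi> holomorphic_on unit_disc" and "inj_on \<phi> unit_disc"
    and "\<forall>z\<in>unit_disc. Re (\<phi> z) > 0"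
    and "\<forall>w\<in>\<phi> ` unit_disc. closed_segment 1 w \<subseteq> \<phi> ` unit_disc"
    and "cnj ` (\<phi> ` unit_disc) = \<phi> ` unit_disc"
    and "\<phi> 0 = 1" and "deriv \<phi> 0 \<in> \<real>" and "Re (deriv \<phi> 0) > 0"
    and "\<phi> has_fps_expansion B"
    and "f \<in> K_s \<phi>"
    and "inverse_near_0 f F"
    and "F has_fps_expansion d"
  shows "norm (fps_nth d 3 - \<mu> * (fps_nth d 2)\<^sup>2)
    \<le> 1 / 3 + max (Re (fps_nth B 1) / 3)
        (norm (fps_nth B 2 / 3 - (2 - \<mu>) * (fps_nth B 1)\<^sup>2 / 4))"
proof -
  define A where "A = fps_expansion f 0"
  have hf: "f holomorphic_on ball 0 1" and f0: "f 0 = 0" and f1: "deriv f 0 = 1"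
    using \<open>f \<in> K_s \<phi>\<close> by (auto simp: K_s_def class_A_def)
  have A: "f has_fps_expansion A"
    unfolding A_def by (rule has_fps_expansion_fps_expansion[OF open_ball _ hf]) auto
  have A0: "fps_nth A 0 = 0" and A1: "fps_nth A 1 = 1"
    using fps_nth_fps_expansion[OF A, of 0] fps_nth_fps_expansion[OF A, of 1] f0 f1 by auto
  obtain w W c where w: "w holomorphic_on ball 0 1" "w 0 = 0"
      "\<And>z. norm z < 1 \<Longrightarrow> norm (w z) < 1" "w has_fps_expansion W"
    and c: "norm c \<le> 1"
    and A2: "2 * fps_nth A 2 = fps_nth B 1 * fps_nth W 1"
    and A3: "3 * fps_nth A 3 = c + fps_nth B 1 * fps_nth W 2 + fps_nth B 2 * (fps_nth W 1)\<^sup>2"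
    using K_s_coeffs[OF \<open>f \<in> K_s \<phi>\<close> A \<open>\<phi> has_fps_expansion B\<close> \<open>\<phi> 0 = 1\<close>] by metis
  define b where "b = Re (fps_nth B 1)"
  have "fps_nth B 1 = deriv \<phi> 0"
    using fps_nth_fps_expansion[OF \<open>\<phi> has_fps_expansion B\<close>, of 1] by simp
  then have B1: "fps_nth B 1 = of_real b" and b: "b > 0"
    using assms(7,8) by (auto simp: b_def)
  \<comment> \<open>Up to sign, \<open>s\<close> is what multiplies the square of the first Schwarz
    coefficient in the functional. Since \<open>s\<close> equals \<open>t * b / 3\<close>, factoring
    out \<open>b / 3\<close> leaves the form bounded by max(1, |t|).\<close>
  define s where "s = fps_nth B 2 / 3 - (2 - \<mu>) * (fps_nth B 1)\<^sup>2 / 4"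
  define t where "t = 3 * s / of_real b"
  have a2: "fps_nth A 2 = fps_nth B 1 * fps_nth W 1 / 2"
    and a3: "fps_nth A 3 = (c + fps_nth B 1 * fps_nth W 2 + fps_nth B 2 * (fps_nth W 1)\<^sup>2) / 3"
    using A2 A3 by (simp_all add: field_simps)
  have "fps_nth d 3 - \<mu> * (fps_nth d 2)\<^sup>2
      = - (c / 3 + (fps_nth B 1 / 3 * fps_nth W 2 + s * (fps_nth W 1)\<^sup>2))"
    unfolding inverse_near_0_nth[OF \<open>inverse_near_0 f F\<close> A \<open>F has_fps_expansion d\<close> A0 A1] a2 a3 s_def
    by (simp add: field_simps power2_eq_square)
  also have "fps_nth B 1 / 3 * fps_nth W 2 + s * (fps_nth W 1)\<^sup>2
      = of_real (b / 3) * (fps_nth W 2 + t * (fps_nth W 1)\<^sup>2)"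
    unfolding B1 t_def using b by (simp add: field_simps)
  finally have "norm (fps_nth d 3 - \<mu> * (fps_nth d 2)\<^sup>2)
      \<le> norm c / 3 + b / 3 * norm (fps_nth W 2 + t * (fps_nth W 1)\<^sup>2)"
    using norm_triangle_ineq[of "c / 3" "of_real (b / 3) * (fps_nth W 2 + t * (fps_nth W 1)\<^sup>2)"] b
    by (simp only: norm_minus_cancel norm_mult norm_of_real) (simp add: norm_divide)
  also have "\<dots> \<le> 1 / 3 + b / 3 * max 1 (norm t)"
    using c b norm_nth2_plus_le_max[OF w, of t] by (intro add_mono mult_left_mono) auto
  also have "b / 3 * max 1 (norm t) = max (b / 3) (norm s)"
    using b by (simp add: t_def norm_divide norm_mult max_mult_distrib_left)
  finally show ?thesis by (simp add: b_def s_def)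
qed

end
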